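(* Let $X$ be a Banach space with a $\mathrm{Fin}$-Schauder basis $\hat{u}=(u_n,u_n^\star)_{n\in\omega}\subseteq X\times X^\star$. For every infinite $E\subseteq\omega$ there is $\hat{a}=(a_n,a_n^\star)_{n\in\omega}\subseteq X\times X^\star$, simple over $\hat{u}$, such that the following are equivalent for every ideal $\mathcal{I}$ on $\omega$: (a) $\hat{a}$ is an $\mathcal{I}$-Schauder basis of $X$; (b) $E\in\mathcal{I}$; (c) $\mathcal{I}_E\subseteq\mathcal{I}$, where $\mathcal{I}_E$ is the ideal on $\omega$ generated by $\mathrm{Fin}\cup\{E\}$. In particular, $\mathcal{CR}(X,\hat{a})=\mathcal{I}_E$.
   Context: $\omega=\{0,1,2,\dots\}$. An ideal on $\omega$ is a family $\mathcal{I}\subseteq\mathcal{P}(\omega)$ containing all finite sets and closed under subsets and finite unions (the trivial ideal $\mathcal{P}(\omega)$ is allowed). $\mathrm{Fin}$ is the ideal of finite subsets of $\omega$. The ideal generated by a family is the family of all subsets of finite unions of its members. $X^\star$ is the continuous dual of $X$, $\mathbb{K}\in\{\mathbb{R},\mathbb{C}\}$ the scalar field. All sequences of pairs $\hat{a}=(a_n,a_n^\star)_{n\in\omega}$ with $a_n\in X$, $a_n^\star:X\to\mathbb{K}$ are assumed biorthogonal: $a_n^\star(a_m)=\delta_{nm}$. Put $S_n(\hat{a})(x)=\sum_{i=0}^n a_i^\star(x)a_i$. For an ideal $\mathcal{I}$ on $\omega$, $\hat{a}$ is an $\mathcal{I}$-Schauder basis of $X$ if $\{n\in\omega:\|x-S_n(\hat{a})(x)\|_X\ge\varepsilon\}\in\mathcal{I}$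 for all $x\in X$, $\varepsilon>0$. (A $\mathrm{Fin}$-Schauder basis is a usual Schauder basis with its coordinate functionals.) The critical ideal $\mathcal{CR}(X,\hat{a})$ is the (unique, possibly trivial) ideal on $\omega$ such that for every ideal $\mathcal{I}$ on $\omega$: $\hat{a}$ is an $\mathcal{I}$-Schauder basis of $X$ iff $\mathcal{CR}(X,\hat{a})\subseteq\mathcal{I}$. $\hat{a}\subseteq X\times X^\star$ is simple over $\hat{u}\subseteq X\times X^\star$ if there are $D\subseteq\omega$, a function $h:D\to\omega$ that is interval-to-one (each $h^{-1}[\{k\}]$ is empty or an interval of $\omega$ contained in $D$), and vectors $(b_k)_{k\in h[D]}\subseteq X\setminus\{0\}$ such that for all $x\in X$: $S_n(\hat{u})(x)-S_n(\hat{a})(x)=0$ if $n\in\omega\setminus D$, and $=u_{h(n)}^\star(x)\,b_{h(n)}$ if $n\in D$. *)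

theory Defs
  imports "HOL-Analysis.Analysis"
begin

text \<open>
  A Banach space over the scalar field \<open>'k\<close>, as an action \<open>scaleK\<close> of \<open>'k\<close> on a type of class
  \<open>banach\<close> (which by itself only carries a real scalar multiplication). By the Gelfand-Mazur theorem
  every type of class \<open>real_normed_field\<close> is isometrically isomorphic to the reals or to the complex
  numbers, so that \<open>'k\<close> ranges over exactly these two fields.
\<close>

locale banach_over = vector_space scaleK
  for scaleK :: "'k::real_normed_field \<Rightarrow> 'a::banach \<Rightarrow> 'a" +
  assumes scale_of_real: "scaleK (of_real r) x = r *\<^sub>R x"
    and norm_scale: "norm (scaleK c x) = norm c * norm x"

lemma banach_over_scaleR: "banach_over ((*\<^sub>R) :: real \<Rightarrow> 'a::banach \<Rightarrow> 'a)"
  by unfold_locales (simp_all add: algebra_simps)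

lemma banach_over_times: "banach_over ((*) :: 'k::{real_normed_field,banach} \<Rightarrow> 'k \<Rightarrow> 'k)"
  by unfold_locales
    (rule distrib_left distrib_right mult.assoc[symmetric] mult_1_left norm_mult
      scaleR_conv_of_real[symmetric])+

definition continuous_dual :: "('k::real_normed_field \<Rightarrow> 'a::banach \<Rightarrow> 'a) \<Rightarrow> ('a \<Rightarrow> 'k) set" where
  "continuous_dual scaleK = {f. Vector_Spaces.linear scaleK (*) f \<and> continuous_on UNIV f}"


text \<open>Ideals on the natural numbers; the improper ideal \<open>UNIV\<close> is allowed.\<close>

definition ideal_on_nat :: "nat set set \<Rightarrow> bool" where
  "ideal_on_nat I \<longleftrightarrow>
     (\<forall>A. finite A \<longrightarrow> A \<in> I) \<and>
     (\<forall>A\<in>I. \<forall>B. B \<subseteq> A \<longrightarrow> B \<in> I) \<and>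
     (\<forall>A\<in>I. \<forall>B\<in>I. A \<union> B \<in> I)"

definition fin_ideal :: "nat set set" where
  "fin_ideal = {A. finite A}"

definition generated_ideal :: "nat set set \<Rightarrow> nat set set" where
  "generated_ideal F = {A. \<exists>G. finite G \<and> G \<subseteq> F \<and> A \<subseteq> \<Union>G}"


text \<open>A sequence of pairs \<open>a\<close> has the vectors \<open>fst (a n)\<close> and the functionals \<open>snd (a n)\<close>.\<close>

definition biorthogonal :: "(nat \<Rightarrow> 'a \<times> ('a \<Rightarrow> 'k::real_normed_field)) \<Rightarrow> bool" where
  "biorthogonal a \<longleftrightarrow> (\<forall>n m. snd (a n) (fst (a m)) = (if n = m then 1 else 0))"

definition partial_sum ::
  "('k::real_normed_field \<Rightarrow> 'a::banach \<Rightarrow> 'a) \<Rightarrow> (nat \<Rightarrow> 'a \<times> ('a \<Rightarrow> 'k)) \<Rightarrow> nat \<Rightarrow> 'a \<Rightarrow> 'a" where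
  "partial_sum scaleK a n x = (\<Sum>i\<le>n. scaleK (snd (a i) x) (fst (a i)))"

definition ideal_schauder_basis ::
  "('k::real_normed_field \<Rightarrow> 'a::banach \<Rightarrow> 'a) \<Rightarrow> nat set set \<Rightarrow> (nat \<Rightarrow> 'a \<times> ('a \<Rightarrow> 'k)) \<Rightarrow> bool" where
  "ideal_schauder_basis scaleK I a \<longleftrightarrow>
     biorthogonal a \<and> (\<forall>x. \<forall>\<epsilon>>0. {n. norm (x - partial_sum scaleK a n x) \<ge> \<epsilon>} \<in> I)"

definition critical_ideal ::
  "('k::real_normed_field \<Rightarrow> 'a::banach \<Rightarrow> 'a) \<Rightarrow> (nat \<Rightarrow> 'a \<times> ('a \<Rightarrow> 'k)) \<Rightarrow> nat set set" where
  "critical_ideal scaleK a =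
     (THE J. ideal_on_nat J \<and>
        (\<forall>I. ideal_on_nat I \<longrightarrow> (ideal_schauder_basis scaleK I a \<longleftrightarrow> J \<subseteq> I)))"

text \<open>The description in \<open>critical_ideal\<close> is a proper one for every biorthogonal sequence.\<close>

lemma ex1_critical_ideal:
  fixes scaleK :: "'k::real_normed_field \<Rightarrow> 'a::banach \<Rightarrow> 'a"
  assumes "biorthogonal a"
  shows "\<exists>!J. ideal_on_nat J \<and>
           (\<forall>I. ideal_on_nat I \<longrightarrow> (ideal_schauder_basis scaleK I a \<longleftrightarrow> J \<subseteq> I))"
proof (rule ex_ex1I)
  define J where "J = \<Inter>{I. ideal_on_nat I \<and> ideal_schauder_basis scaleK I a}"
  have J: "ideal_on_nat J"
  proof -
    have "A \<in> J" if "finite A" for A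
      using that by (simp add: J_def ideal_on_nat_def)
    moreover have "B \<in> J" if "A \<in> J" "B \<subseteq> A" for A B
      unfolding J_def
    proof (rule InterI)
      fix I assume I: "I \<in> {I. ideal_on_nat I \<and> ideal_schauder_basis scaleK I a}"
      with \<open>A \<in> J\<close> have "A \<in> I" unfolding J_def by (rule InterD)
      with I \<open>B \<subseteq> A\<close> show "B \<in> I" by (simp add: ideal_on_nat_def)
    qed
    moreover have "A \<union> B \<in> J" if "A \<in> J" "B \<in> J" for A B
      using that by (simp add: J_def ideal_on_nat_def)
    ultimately show ?thesis
      by (simp add: ideal_on_nat_def)
  qed
  have basis_J: "ideal_schauder_basis scaleK J a"
    using assms by (simp add: J_def ideal_schauder_basis_def)
  have "ideal_schauder_basis scaleK I a \<longleftrightarrow> J \<subseteq> I" if I: "ideal_on_nat I" for I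
  proof
    assume "ideal_schauder_basis scaleK I a"
    with I show "J \<subseteq> I" by (simp add: J_def Inter_lower)
  next
    assume "J \<subseteq> I"
    with basis_J show "ideal_schauder_basis scaleK I a"
      by (simp add: ideal_schauder_basis_def subset_iff)
  qed
  with J show "\<exists>J. ideal_on_nat J \<and>
           (\<forall>I. ideal_on_nat I \<longrightarrow> (ideal_schauder_basis scaleK I a \<longleftrightarrow> J \<subseteq> I))"
    by metis
next
  fix J J'
  assume "ideal_on_nat J \<and>
      (\<forall>I. ideal_on_nat I \<longrightarrow> (ideal_schauder_basis scaleK I a \<longleftrightarrow> J \<subseteq> I))"
    and "ideal_on_nat J' \<and>
      (\<forall>I. ideal_on_nat I \<longrightarrow> (ideal_schauder_basis scaleK I a \<longleftrightarrow> J' \<subseteq> I))"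
  then show "J = J'"
    by (meson subset_antisym subset_refl)
qed


text \<open>
  The condition on \<open>D\<close> and \<open>h\<close> says that each fibre of \<open>h : D \<rightarrow> \<omega>\<close> is an order-convex subset of
  \<open>D\<close>, i.e. empty or a (possibly infinite) interval. Only the values of \<open>h\<close> on \<open>D\<close> and of \<open>b\<close> on
  \<open>h ` D\<close> matter.
\<close>

definition simple_over ::
  "('k::real_normed_field \<Rightarrow> 'a::banach \<Rightarrow> 'a) \<Rightarrow>
   (nat \<Rightarrow> 'a \<times> ('a \<Rightarrow> 'k)) \<Rightarrow> (nat \<Rightarrow> 'a \<times> ('a \<Rightarrow> 'k)) \<Rightarrow> bool" where
  "simple_over scaleK a u \<longleftrightarrow>
     (\<exists>(D :: nat set) (h :: nat \<Rightarrow> nat) (b :: nat \<Rightarrow> 'a).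
        (\<forall>k. \<forall>i\<in>{n\<in>D. h n = k}. \<forall>j\<in>{n\<in>D. h n = k}. {i..j} \<subseteq> {n\<in>D. h n = k}) \<and>
        (\<forall>k\<in>h ` D. b k \<noteq> 0) \<and>
        (\<forall>x n. partial_sum scaleK u n x - partial_sum scaleK a n x =
                 (if n \<in> D then scaleK (snd (u (h n)) x) (b (h n)) else 0)))"

end

theory Submission
  imports Defs
begin

text \<open>
  For scalars \<open>c\<^sub>n\<close> put \<open>v\<^sub>0 = u\<^sub>0\<close>, \<open>v\<^sub>n\<^sub>+\<^sub>1 = u\<^sub>n\<^sub>+\<^sub>1 + c\<^sub>n v\<^sub>n\<close> and pair \<open>v\<^sub>n\<close> with the functional
  \<open>u\<^sub>n\<^sup>\<star> - c\<^sub>n u\<^sub>n\<^sub>+\<^sub>1\<^sup>\<star>\<close>. By Abel summation the \<open>n\<close>-th partial sum of the new system is that of \<open>u\<close>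
  minus \<open>c\<^sub>n u\<^sub>n\<^sub>+\<^sub>1\<^sup>\<star>(x) v\<^sub>n\<close>. With \<open>c\<^sub>n = 0\<close> off \<open>E\<close>, the new partial sums converge along the
  complement of \<open>E\<close>. On \<open>E\<close> the scalar \<open>c\<^sub>n\<close> is chosen so large that the error term has norm \<open>1\<close> for
  all \<open>n \<in> E\<close> at the single vector \<open>x = \<Sum>\<^sub>i \<epsilon>\<^sub>i u\<^sub>i\<close>, where the \<open>\<epsilon>\<^sub>i > 0\<close> make the series absolutely
  convergent.
\<close>

lemma generated_idealI: "finite G \<Longrightarrow> G \<subseteq> F \<Longrightarrow> A \<subseteq> \<Union>G \<Longrightarrow> A \<in> generated_ideal F"
  by (auto simp: generated_ideal_def)

lemma generated_idealE:
  assumes "A \<in> generated_ideal F"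
  obtains G where "finite G" "G \<subseteq> F" "A \<subseteq> \<Union>G"
  using assms by (auto simp: generated_ideal_def)

lemma generated_ideal_incl: "A \<in> F \<Longrightarrow> A \<in> generated_ideal F"
  by (rule generated_idealI[of "{A}"]) auto

lemma ideal_generated: "ideal_on_nat (generated_ideal F)" if "fin_ideal \<subseteq> F"
proof -
  have "A \<in> generated_ideal F" if "finite A" for A
    using that \<open>fin_ideal \<subseteq> F\<close> by (auto simp: fin_ideal_def intro: generated_ideal_incl)
  moreover have "B \<in> generated_ideal F" if "A \<in> generated_ideal F" "B \<subseteq> A" for A B
    using that by (meson generated_idealE generated_idealI subset_trans)
  moreover have "A \<union> B \<in> generated_ideal F"
    if A: "A \<in> generated_ideal F" and B: "B \<in> generated_ideal F" for A B
  proof -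
    obtain G where "finite G" "G \<subseteq> F" "A \<subseteq> \<Union>G"
      using A by (rule generated_idealE)
    moreover obtain H where "finite H" "H \<subseteq> F" "B \<subseteq> \<Union>H"
      using B by (rule generated_idealE)
    ultimately show ?thesis
      by (intro generated_idealI[of "G \<union> H"]) auto
  qed
  ultimately show ?thesis
    by (simp add: ideal_on_nat_def)
qed

lemma generated_ideal_subset_iff:
  assumes "ideal_on_nat I"
  shows "generated_ideal F \<subseteq> I \<longleftrightarrow> F \<subseteq> I"
proof
  show "F \<subseteq> I" if "generated_ideal F \<subseteq> I"
    using that generated_ideal_incl by (meson subset_iff)
next
  assume "F \<subseteq> I"
  have union: "\<Union>G \<in> I" if "finite G" "G \<subseteq> F" for G
    using that
  proof (induction G rule: finite_induct)
    case empty
    show ?case using assms by (simp add: ideal_on_nat_def)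
  next
    case (insert A G)
    then have "A \<in> I" "\<Union>G \<in> I" using \<open>F \<subseteq> I\<close> by auto
    then show ?case using assms by (simp add: ideal_on_nat_def)
  qed
  show "generated_ideal F \<subseteq> I"
  proof
    fix A assume "A \<in> generated_ideal F"
    then obtain G where "finite G" "G \<subseteq> F" "A \<subseteq> \<Union>G"
      by (rule generated_idealE)
    with union assms show "A \<in> I" unfolding ideal_on_nat_def by blast
  qed
qed

text \<open>Every ideal contains the finite sets, so \<open>E\<close> is the only generator that
  imposes a condition. This is the equivalence of (b) and (c).\<close>

lemma generated_ideal_fin_insert_subset_iff:
  assumes "ideal_on_nat I"
  shows "generated_ideal (fin_ideal \<union> {E}) \<subseteq> I \<longleftrightarrow> E \<in> I"
  using assms by (auto simp: generated_ideal_subset_iff fin_ideal_def ideal_on_nat_def)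

lemma critical_ideal_eqI:
  assumes "biorthogonal a" and "ideal_on_nat J"
    and "\<And>I. ideal_on_nat I \<Longrightarrow> ideal_schauder_basis scaleK I a \<longleftrightarrow> J \<subseteq> I"
  shows "critical_ideal scaleK a = J"
  unfolding critical_ideal_def
  by (rule the1_equality[OF ex1_critical_ideal]) (use assms in auto)

context banach_over
begin

lemma continuous_dual_add: "f (x + y) = f x + f y" if "f \<in> continuous_dual scaleK"
  using that by (simp add: continuous_dual_def Vector_Spaces.linear_iff)

lemma continuous_dual_scale: "f (scaleK c x) = c * f x" if "f \<in> continuous_dual scaleK"
  using that by (simp add: continuous_dual_def Vector_Spaces.linear_iff)

lemma continuous_dual_zero: "f 0 = 0" if "f \<in> continuous_dual scaleK"
  using continuous_dual_add[OF that, of 0 0] by simp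

lemma continuous_dual_sum:
  assumes "f \<in> continuous_dual scaleK"
  shows "f (sum g A) = (\<Sum>i\<in>A. f (g i))"
  by (induction A rule: infinite_finite_induct)
    (simp_all add: continuous_dual_add[OF assms] continuous_dual_zero[OF assms])

lemma continuous_dual_diff_times:
  assumes "f \<in> continuous_dual scaleK" "g \<in> continuous_dual scaleK"
  shows "(\<lambda>x. f x - c * g x) \<in> continuous_dual scaleK"
  using assms unfolding continuous_dual_def
  by (auto simp: Vector_Spaces.linear_iff algebra_simps intro!: continuous_intros)

lemma exists_positive_coordinates:
  assumes dual: "\<And>n. snd (u n) \<in> continuous_dual scaleK"
    and bi: "biorthogonal u"
  obtains x and \<epsilon> :: "nat \<Rightarrow> real"
  where "\<And>n. \<epsilon> n > 0" and "\<And>n. snd (u n) x = of_real (\<epsilon> n)"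
proof -
  \<comment> \<open>Adding 1 to the norm keeps the denominator positive and bounds the i-th term of
    the series by \<open>(1/2) ^ i\<close>.\<close>
  define \<epsilon> :: "nat \<Rightarrow> real" where "\<epsilon> i = (1/2) ^ i / (1 + norm (fst (u i)))" for i
  have pos: "\<epsilon> n > 0" for n
    by (simp add: \<epsilon>_def add_pos_nonneg)
  define g where "g i = scaleK (of_real (\<epsilon> i)) (fst (u i))" for i
  have "norm (g i) \<le> (1/2) ^ i" for i
  proof -
    have "norm (g i) = (1/2) ^ i * (norm (fst (u i)) / (1 + norm (fst (u i))))"
      unfolding g_def norm_scale norm_of_real by (simp add: \<epsilon>_def)
    also have "\<dots> \<le> (1/2) ^ i * 1"
      by (intro mult_left_mono) (simp_all add: add_pos_nonneg divide_le_eq_1)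
    finally show ?thesis by simp
  qed
  moreover have "summable (\<lambda>i. (1/2 :: real) ^ i)"
    by (simp add: summable_geometric)
  ultimately have "summable g"
    by (rule summable_comparison_test'[rotated])
  then have lim: "(\<lambda>m. \<Sum>i<m. g i) \<longlonglongrightarrow> suminf g"
    by (rule summable_LIMSEQ)
  \<comment> \<open>By biorthogonality the n-th coordinate of the partial sums is constant for
    \<open>m > n\<close>; continuity of the functional carries this value to the limit.\<close>
  have "snd (u n) (suminf g) = of_real (\<epsilon> n)" for n
  proof (rule LIMSEQ_unique)
    have "isCont (snd (u n)) (suminf g)"
      using dual[of n] by (simp add: continuous_dual_def continuous_on_eq_continuous_at)
    then show "(\<lambda>m. snd (u n) (\<Sum>i<m. g i)) \<longlonglongrightarrow> snd (u n) (suminf g)"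
      using lim by (rule isCont_tendsto_compose)
    have "snd (u n) (\<Sum>i<m. g i) = of_real (\<epsilon> n)" if "m > n" for m
      using bi that
      by (simp add: continuous_dual_sum[OF dual] g_def continuous_dual_scale[OF dual]
          biorthogonal_def if_distrib[of "(*) _"] cong: if_cong)
    then show "(\<lambda>m. snd (u n) (\<Sum>i<m. g i)) \<longlonglongrightarrow> of_real (\<epsilon> n)"
      by (intro tendsto_eventually eventually_sequentiallyI[of "Suc n"]) auto
  qed
  with pos that show thesis by blast
qed

end

text \<open>The recursion for \<open>v\<close> is assumed rather than solved for a given
  \<open>c\<close>, so that \<open>c n\<close> may itself depend on \<open>v n\<close>; the later
  normalisation needs this.\<close>

locale abel_chain = banach_over scaleK
  for scaleK :: "'k::real_normed_field \<Rightarrow> 'a::banach \<Rightarrow> 'a" +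
  fixes u a :: "nat \<Rightarrow> 'a \<times> ('a \<Rightarrow> 'k)"
    and v :: "nat \<Rightarrow> 'a"
    and c :: "nat \<Rightarrow> 'k"
  assumes dual: "\<And>n. snd (u n) \<in> continuous_dual scaleK"
    and bi: "biorthogonal u"
    and v_0: "v 0 = fst (u 0)"
    and v_Suc: "\<And>n. v (Suc n) = fst (u (Suc n)) + scaleK (c n) (v n)"
    and a_eq: "\<And>n. a n = (v n, \<lambda>x. snd (u n) x - c n * snd (u (Suc n)) x)"
begin

lemma chain_dual: "snd (a n) \<in> continuous_dual scaleK"
  by (simp add: a_eq continuous_dual_diff_times dual)

text \<open>The n-th new functional takes the value \<open>- c n\<close> at the vector of
  \<open>u (Suc n)\<close>. The summand \<open>scaleK (c n) (v n)\<close> of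
  \<open>v (Suc n)\<close> contributes \<open>c n\<close> and cancels it; induction on
  \<open>m\<close> propagates this along the chain.\<close>

lemma chain_biorthogonal: "biorthogonal a"
proof -
  have u: "snd (a n) (fst (u m)) = (if n = m then 1 else 0) - (if Suc n = m then c n else 0)" for n m
    using bi by (simp add: a_eq biorthogonal_def)
  have "snd (a n) (v m) = (if n = m then 1 else 0)" for n m
  proof (induction m)
    case 0
    show ?case by (simp add: v_0 u)
  next
    case (Suc m)
    then show ?case
      by (simp add: v_Suc u continuous_dual_add[OF chain_dual] continuous_dual_scale[OF chain_dual])
  qed
  then show ?thesis
    by (simp add: biorthogonal_def a_eq)
qed

lemma chain_nonzero: "v n \<noteq> 0"
proof
  assume "v n = 0"
  then have "snd (a n) (fst (a n)) = 0"
    using continuous_dual_zero[OF chain_dual[of n]] by (simp add: a_eq)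
  with chain_biorthogonal show False by (simp add: biorthogonal_def)
qed

text \<open>The sum telescopes: the old error plus the next term of \<open>u\<close> is
  \<open>snd (u (Suc n)) x\<close> times \<open>v (Suc n)\<close>, and subtracting the next term of
  \<open>a\<close> leaves exactly the new error.\<close>

lemma chain_partial_sum:
  "partial_sum scaleK u n x - partial_sum scaleK a n x = scaleK (c n * snd (u (Suc n)) x) (v n)"
proof (induction n)
  case 0
  show ?case
    by (simp add: partial_sum_def a_eq v_0 scale_left_diff_distrib)
next
  case (Suc n)
  have "partial_sum scaleK u (Suc n) x - partial_sum scaleK a (Suc n) x =
      scaleK (c n * snd (u (Suc n)) x) (v n) + scaleK (snd (u (Suc n)) x) (fst (u (Suc n)))
      - scaleK (snd (a (Suc n)) x) (v (Suc n))"
    using Suc.IH by (simp add: partial_sum_def a_eq algebra_simps)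
  also have "\<dots> = scaleK (c (Suc n) * snd (u (Suc (Suc n))) x) (v (Suc n))"
    by (simp add: a_eq v_Suc algebra_simps)
  finally show ?case .
qed

lemma chain_simple_over: "simple_over scaleK a u"
  unfolding simple_over_def
proof (intro exI conjI)
  \<comment> \<open>With \<open>h = Suc\<close> every fibre has at most one point. Since
    \<open>b\<close> is indexed by the values of \<open>h\<close>, the shift \<open>k - 1\<close>
    recovers \<open>n\<close>; only \<open>k > 0\<close> occurs.\<close>
  let ?D = "{n. c n \<noteq> 0}" and ?b = "\<lambda>k. scaleK (c (k - 1)) (v (k - 1))"
  show "\<forall>k. \<forall>i\<in>{n\<in>?D. Suc n = k}. \<forall>j\<in>{n\<in>?D. Suc n = k}. {i..j} \<subseteq> {n\<in>?D. Suc n = k}"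
    by auto
  show "\<forall>k\<in>Suc ` ?D. ?b k \<noteq> 0"
    by (auto simp: chain_nonzero)
  show "\<forall>x n. partial_sum scaleK u n x - partial_sum scaleK a n x =
          (if n \<in> ?D then scaleK (snd (u (Suc n)) x) (?b (Suc n)) else 0)"
    by (simp add: chain_partial_sum mult.commute)
qed

end

theorem theorem4p1:
  fixes scaleK :: "'k::real_normed_field \<Rightarrow> 'a::banach \<Rightarrow> 'a"
    and u :: "nat \<Rightarrow> 'a \<times> ('a \<Rightarrow> 'k)"
    and E :: "nat set"
  assumes "banach_over scaleK"
    and "range u \<subseteq> UNIV \<times> continuous_dual scaleK"
    and "ideal_schauder_basis scaleK fin_ideal u"
    and "infinite E"
  shows "\<exists>a :: nat \<Rightarrow> 'a \<times> ('a \<Rightarrow> 'k).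
    range a \<subseteq> UNIV \<times> continuous_dual scaleK \<and>
    biorthogonal a \<and>
    simple_over scaleK a u \<and>
    (\<forall>I. ideal_on_nat I \<longrightarrow>
      (ideal_schauder_basis scaleK I a \<longleftrightarrow> E \<in> I) \<and>
      (E \<in> I \<longleftrightarrow> generated_ideal (fin_ideal \<union> {E}) \<subseteq> I)) \<and>
    critical_ideal scaleK a = generated_ideal (fin_ideal \<union> {E})"
proof -
  interpret banach_over scaleK by fact
  have dual: "snd (u n) \<in> continuous_dual scaleK" for n
    using assms(2) by (auto simp: image_subset_iff mem_Times_iff)
  have bi: "biorthogonal u"
    using assms(3) by (simp add: ideal_schauder_basis_def)
  have finite_u: "finite {n. norm (x - partial_sum scaleK u n x) \<ge> e}" if "e > 0" for x e
    using assms(3) that by (simp add: ideal_schauder_basis_def fin_ideal_def)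
  obtain x0 and \<epsilon> :: "nat \<Rightarrow> real"
    where \<epsilon>_pos: "\<And>n. \<epsilon> n > 0" and x0: "\<And>n. snd (u n) x0 = of_real (\<epsilon> n)"
    by (rule exists_positive_coordinates[OF dual bi]) (rule that; assumption)
  \<comment> \<open>The vector \<open>w\<close> is an argument because \<open>c n\<close> depends on
    \<open>v n\<close>, which in turn depends on the earlier scalars; so \<open>v\<close> comes from
    primitive recursion. The value on \<open>E\<close> is the reciprocal of the norm that the error
    at \<open>x0\<close> would have with scalar 1.\<close>
  define \<kappa> :: "nat \<Rightarrow> 'a \<Rightarrow> 'k"
    where "\<kappa> n w = (if n \<in> E then of_real (1 / (\<epsilon> (Suc n) * norm w)) else 0)" for n w
  define v where "v = rec_nat (fst (u 0)) (\<lambda>n w. fst (u (Suc n)) + scaleK (\<kappa> n w) w)"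
  define c where "c n = \<kappa> n (v n)" for n
  define a where "a n = (v n, \<lambda>x. snd (u n) x - c n * snd (u (Suc n)) x)" for n
  have v_0: "v 0 = fst (u 0)" and v_Suc: "v (Suc n) = fst (u (Suc n)) + scaleK (c n) (v n)" for n
    by (simp_all add: v_def c_def)
  interpret abel_chain scaleK u a v c
    by unfold_locales (fact dual bi v_0 v_Suc a_def)+
  have a_dual: "range a \<subseteq> UNIV \<times> continuous_dual scaleK"
    using chain_dual by (simp add: image_subset_iff mem_Times_iff)
  have a_bi: "biorthogonal a"
    by (rule chain_biorthogonal)
  have off_E: "partial_sum scaleK a n x = partial_sum scaleK u n x" if "n \<notin> E" for n x
    using chain_partial_sum[of n x] that by (simp add: c_def \<kappa>_def)
  \<comment> \<open>Cancelling the norm of \<open>v n\<close> is legitimate because biorthogonality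
    forces \<open>v n\<close> to be nonzero.\<close>
  have on_E: "norm (partial_sum scaleK u n x0 - partial_sum scaleK a n x0) = 1" if "n \<in> E" for n
    using \<epsilon>_pos[of "Suc n"] chain_nonzero[of n] that
    by (simp add: chain_partial_sum norm_scale norm_mult norm_divide x0 c_def \<kappa>_def)
  have basis_iff: "ideal_schauder_basis scaleK I a \<longleftrightarrow> E \<in> I" if I: "ideal_on_nat I" for I
  proof
    assume basis: "ideal_schauder_basis scaleK I a"
    \<comment> \<open>For \<open>n\<close> in \<open>E\<close> the two partial sums are at distance
      1, so they cannot both lie within less than 1/2 of \<open>x0\<close>.\<close>
    let ?A = "{n. norm (x0 - partial_sum scaleK a n x0) \<ge> 1/2}"
      and ?B = "{n. norm (x0 - partial_sum scaleK u n x0) \<ge> 1/2}"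
    have "E \<subseteq> ?A \<union> ?B"
    proof
      fix n assume "n \<in> E"
      have "1 \<le> norm (x0 - partial_sum scaleK a n x0) + norm (x0 - partial_sum scaleK u n x0)"
        using on_E[OF \<open>n \<in> E\<close>]
          norm_triangle_ineq4[of "x0 - partial_sum scaleK a n x0" "x0 - partial_sum scaleK u n x0"]
        by simp
      then show "n \<in> ?A \<union> ?B" by auto
    qed
    moreover have "?A \<in> I"
      using basis half_gt_zero[OF zero_less_one] unfolding ideal_schauder_basis_def by blast
    moreover have "finite ?B"
      by (rule finite_u) simp
    ultimately show "E \<in> I"
      using I unfolding ideal_on_nat_def by meson
  next
    assume "E \<in> I"
    have "{n. norm (x - partial_sum scaleK a n x) \<ge> e} \<in> I" if "e > 0" for x e
    proof -
      have "finite {n. norm (x - partial_sum scaleK u n x) \<ge> e}"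
        using that by (rule finite_u)
      \<comment> \<open>Outside \<open>E\<close> the two systems have equal partial sums, so any
        further exceptional index lies in \<open>E\<close>.\<close>
      moreover have "{n. norm (x - partial_sum scaleK a n x) \<ge> e} \<subseteq>
          E \<union> {n. norm (x - partial_sum scaleK u n x) \<ge> e}"
        using off_E by auto
      ultimately show ?thesis
        using I \<open>E \<in> I\<close> unfolding ideal_on_nat_def by meson
    qed
    with a_bi show "ideal_schauder_basis scaleK I a"
      by (simp add: ideal_schauder_basis_def)
  qed
  have "critical_ideal scaleK a = generated_ideal (fin_ideal \<union> {E})"
    using a_bi ideal_generated[OF Un_upper1]
    by (rule critical_ideal_eqI) (simp only: basis_iff generated_ideal_fin_insert_subset_iff)
  with a_dual a_bi chain_simple_over basis_iff show ?thesis
    by (intro exI[of _ a]) (simp add: generated_ideal_fin_insert_subset_iff del: Un_insert_right)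
qed

end
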